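(* Let $k\ge 4$, let $G$ be a finite simple bipartite graph with bipartition $V(G)=A\sqcup B$, $|A|=2k$, and let $(x_1,y_1),\dots,(x_k,y_k)$ be an oriented perfect matching of $A$, with initial rows $\rho(b)$, $b\in B$. The oriented matching fails to be feasible if and only if at least one of the following holds: (1) there are distinct $b,c\in B$ with fixed rows such that $\rho_i(b)<\rho_i(c)$ for every $i\in\{1,\dots,k\}$; (2) there is a one-star row $c\in B$ whose Boolean variable $t_c$ is directly forced both to $0$ and to $1$. Moreover, in case (2), if the star of $c$ is at coordinate $j$, there are $L,U\in B$ with fixed rows such that, for every $i\ne j$, $$(\rho_i(L),\rho_i(c),\rho_i(U))=(1,2,3).$$ In particular, $c$ is adjacent to every vertex of $A$ except the two vertices $x_j,y_j$ of pair $j$.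
   Context: An oriented (perfect) matching of $A$, $|A|=2k$, is a partition of $A$ into $k$ pairs together with a choice of first and second vertex in each pair, written $(x_1,y_1),\dots,(x_k,y_k)$; the pairs need not be edges of $G$. For $b\in B$, the initial row $\rho(b)=(\rho_1(b),\dots,\rho_k(b))\in\{\ast,1,2,3\}^k$ is defined by: $\rho_i(b)=\ast$ if $b$ is adjacent to neither $x_i$ nor $y_i$; $\rho_i(b)=1$ if $b$ is adjacent to $x_i$ but not $y_i$; $\rho_i(b)=2$ if $b$ is adjacent to both; $\rho_i(b)=3$ if $b$ is adjacent to $y_i$ but not $x_i$. Rows are indexed by vertices $b\in B$ (different vertices may have equal rows), and we identify $b$ with its row. A completion of $\rho(b)$ is a vector $r(b)\in\{0,1,2,3,4\}^k$ with $r_i(b)=\rho_i(b)$ whenever $\rho_i(b)\neq\ast$ and $r_i(b)\in\{0,4\}$ whenever $\rho_i(b)=\ast$ (each star is chosen independently). The oriented matching is feasible if one can choose completions $r(b)$, $b\in B$, such that there are no distinct $b,c\in B$ with $r_i(b)<r_i(c)$ for every $i$. A row is fixed if it has no star and one-star if it has exactly one star. For distinct $b,c\in B$, write $b\prec_* c$ if $\rho_i(b)<\rho_i(c)$ at every coordinate $i$ where neither row has a star. Each one-star row $c$ has a Boolean variable $t_c$, where $t_c=0$ means its star is assigned $0$ and $t_c=1$ means its star is assigned $4$. The variable $t_c$ is directly forced to $1$ if there is a fixed row $u$ with $c\prec_* u$, and directly forced to $0$ if there is a fixed row $l$ with $l\prec_* c$. *)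

theory Defs
  imports Main "HOL-Library.Disjoint_Sets"
begin

definition simple_graph :: "'a set \<Rightarrow> 'a set set \<Rightarrow> bool" where
  "simple_graph V E \<longleftrightarrow> finite V \<and> (\<forall>e\<in>E. e \<subseteq> V \<and> card e = 2)"

definition bipartition :: "'a set \<Rightarrow> 'a set set \<Rightarrow> 'a set \<Rightarrow> 'a set \<Rightarrow> bool" where
  "bipartition V E A B \<longleftrightarrow>
     V = A \<union> B \<and> A \<inter> B = {} \<and> (\<forall>e\<in>E. \<exists>a\<in>A. \<exists>b\<in>B. e = {a, b})"

definition adjacent :: "'a set set \<Rightarrow> 'a \<Rightarrow> 'a \<Rightarrow> bool" where
  "adjacent E u v \<longleftrightarrow> {u, v} \<in> E"

(* Only the values of x and y on {1..k} matter; the pairs need not be edges of the graph. *)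
definition oriented_matching :: "'a set \<Rightarrow> nat \<Rightarrow> (nat \<Rightarrow> 'a) \<Rightarrow> (nat \<Rightarrow> 'a) \<Rightarrow> bool" where
  "oriented_matching A k x y \<longleftrightarrow>
     (\<forall>i\<in>{1..k}. x i \<noteq> y i) \<and>
     inj_on (\<lambda>i. {x i, y i}) {1..k} \<and>
     partition_on A ((\<lambda>i. {x i, y i}) ` {1..k})"

(* None encodes a star. Rows are families indexed by the vertices of B, so that distinct
   vertices with equal rows remain distinct. *)
definition initial_row ::
    "'a set set \<Rightarrow> (nat \<Rightarrow> 'a) \<Rightarrow> (nat \<Rightarrow> 'a) \<Rightarrow> 'a \<Rightarrow> nat \<Rightarrow> nat option" where
  "initial_row E x y b i =
     (if adjacent E b (x i)
      then (if adjacent E b (y i) then Some 2 else Some 1)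
      else (if adjacent E b (y i) then Some 3 else None))"

definition completion :: "nat \<Rightarrow> (nat \<Rightarrow> nat option) \<Rightarrow> (nat \<Rightarrow> nat) \<Rightarrow> bool" where
  "completion k \<rho> r \<longleftrightarrow>
     (\<forall>i\<in>{1..k}. case \<rho> i of None \<Rightarrow> r i \<in> {0, 4} | Some v \<Rightarrow> r i = v)"

definition feasible ::
    "'a set set \<Rightarrow> 'a set \<Rightarrow> nat \<Rightarrow> (nat \<Rightarrow> 'a) \<Rightarrow> (nat \<Rightarrow> 'a) \<Rightarrow> bool" where
  "feasible E B k x y \<longleftrightarrow>
     (\<exists>r. (\<forall>b\<in>B. completion k (initial_row E x y b) (r b)) \<and>
          \<not> (\<exists>b\<in>B. \<exists>c\<in>B. b \<noteq> c \<and> (\<forall>i\<in>{1..k}. r b i < r c i)))"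

definition star_coords :: "nat \<Rightarrow> (nat \<Rightarrow> nat option) \<Rightarrow> nat set" where
  "star_coords k \<rho> = {i \<in> {1..k}. \<rho> i = None}"

definition fixed_row :: "nat \<Rightarrow> (nat \<Rightarrow> nat option) \<Rightarrow> bool" where
  "fixed_row k \<rho> \<longleftrightarrow> star_coords k \<rho> = {}"

definition one_star_row :: "nat \<Rightarrow> (nat \<Rightarrow> nat option) \<Rightarrow> bool" where
  "one_star_row k \<rho> \<longleftrightarrow> card (star_coords k \<rho>) = 1"

definition prec_star :: "nat \<Rightarrow> ('a \<Rightarrow> nat \<Rightarrow> nat option) \<Rightarrow> 'a \<Rightarrow> 'a \<Rightarrow> bool" where
  "prec_star k \<rho> b c \<longleftrightarrow>
     b \<noteq> c \<and>
     (\<forall>i\<in>{1..k}. \<rho> b i \<noteq> None \<and> \<rho> c i \<noteq> None \<longrightarrow> the (\<rho> b i) < the (\<rho> c i))"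

(* The Boolean variable t_c of a one-star row c is 0 if the star of c is assigned 0, and 1 if
   it is assigned 4. The next two predicates, meant for one-star rows c, say that t_c is
   directly forced to 1, respectively to 0. *)
definition directly_forced_1 :: "'a set \<Rightarrow> nat \<Rightarrow> ('a \<Rightarrow> nat \<Rightarrow> nat option) \<Rightarrow> 'a \<Rightarrow> bool" where
  "directly_forced_1 B k \<rho> c \<longleftrightarrow> (\<exists>u\<in>B. fixed_row k (\<rho> u) \<and> prec_star k \<rho> c u)"

definition directly_forced_0 :: "'a set \<Rightarrow> nat \<Rightarrow> ('a \<Rightarrow> nat \<Rightarrow> nat option) \<Rightarrow> 'a \<Rightarrow> bool" where
  "directly_forced_0 B k \<rho> c \<longleftrightarrow> (\<exists>l\<in>B. fixed_row k (\<rho> l) \<and> prec_star k \<rho> l c)"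

definition fixed_conflict :: "'a set \<Rightarrow> nat \<Rightarrow> ('a \<Rightarrow> nat \<Rightarrow> nat option) \<Rightarrow> bool" where
  "fixed_conflict B k \<rho> \<longleftrightarrow>
     (\<exists>b\<in>B. \<exists>c\<in>B. b \<noteq> c \<and> fixed_row k (\<rho> b) \<and> fixed_row k (\<rho> c) \<and>
        (\<forall>i\<in>{1..k}. the (\<rho> b i) < the (\<rho> c i)))"

definition forcing_conflict_at :: "'a set \<Rightarrow> nat \<Rightarrow> ('a \<Rightarrow> nat \<Rightarrow> nat option) \<Rightarrow> 'a \<Rightarrow> bool" where
  "forcing_conflict_at B k \<rho> c \<longleftrightarrow>
     one_star_row k (\<rho> c) \<and> directly_forced_0 B k \<rho> c \<and> directly_forced_1 B k \<rho> c"

end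

theory Submission
  imports Defs
begin

text \<open>A row with two or more stars is made incomparable to every other row by giving one star
  the value 0 and another the value 4. For one-star rows, the constraints are the direct forcings
  together with the implications \<open>t\<^sub>d = 1 \<longrightarrow> t\<^sub>c = 1\<close> whenever \<open>c \<prec>\<^sub>* d\<close>. An unsatisfiable system
  therefore yields a chain \<open>L \<prec>\<^sub>* c\<^sub>0 \<prec>\<^sub>* \<dots> \<prec>\<^sub>* c\<^sub>m \<prec>\<^sub>* U\<close> with \<open>L\<close> and \<open>U\<close> fixed and all
  \<open>c\<^sub>i\<close> one-star. If \<open>m \<ge> 1\<close>, the last three of its first four rows have at most three stars in total, so
  for \<open>k \<ge> 4\<close> some coordinate carries four strictly increasing values from \<open>{1, 2, 3}\<close>, which is
  absurd. Hence \<open>m = 0\<close>, and some row is directly forced both ways.\<close>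

section \<open>Stars and short chains of rows\<close>

lemma initial_row_range:
  "\<forall>b i v. initial_row E x y b i = Some v \<longrightarrow> 1 \<le> v \<and> v \<le> 3"
  by (auto simp: initial_row_def split: if_splits)

lemma finite_star_coords [simp]: "finite (star_coords k \<rho>)"
  by (simp add: star_coords_def)

lemma fixed_rowD: "fixed_row k \<rho> \<Longrightarrow> i \<in> {1..k} \<Longrightarrow> \<exists>v. \<rho> i = Some v"
  by (auto simp: fixed_row_def star_coords_def)

lemma one_star_rowE:
  assumes "one_star_row k \<rho>"
  obtains j where "j \<in> {1..k}" "\<rho> j = None" "\<And>i. i \<in> {1..k} \<Longrightarrow> i \<noteq> j \<Longrightarrow> \<exists>v. \<rho> i = Some v"
proof -
  obtain j where "star_coords k \<rho> = {j}"
    using assms unfolding one_star_row_def by (rule card_1_singletonE)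
  then have j: "i = j \<longleftrightarrow> i \<in> {1..k} \<and> \<rho> i = None" for i
    by (metis (mono_tags, lifting) mem_Collect_eq singleton_iff star_coords_def)
  show thesis
  proof
    show "j \<in> {1..k}" "\<rho> j = None" using j[of j] by simp_all
    show "\<exists>v. \<rho> i = Some v" if "i \<in> {1..k}" "i \<noteq> j" for i
      using j[of i] that by simp
  qed
qed

text \<open>Because stars break transitivity of \<open>prec_star\<close>, the argument needs a
  coordinate that is free of stars in all four rows at once. The bound of one star admits both fixed
  and one-star rows, so the top of the chain may be of either kind.\<close>

lemma no_prec_star_chain4:
  assumes k: "k \<ge> 4"
    and range: "\<forall>b i v. \<rho> b i = Some v \<longrightarrow> 1 \<le> v \<and> v \<le> 3"
    and stars: "fixed_row k (\<rho> a)" "card (star_coords k (\<rho> b)) \<le> 1"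
      "card (star_coords k (\<rho> c)) \<le> 1" "card (star_coords k (\<rho> d)) \<le> 1"
    and chain: "prec_star k \<rho> a b" "prec_star k \<rho> b c" "prec_star k \<rho> c d"
  shows False
proof -
  let ?S = "star_coords k (\<rho> b) \<union> star_coords k (\<rho> c) \<union> star_coords k (\<rho> d)"
  have "card ?S \<le> 3"
    using card_Un_le[of "star_coords k (\<rho> b) \<union> star_coords k (\<rho> c)" "star_coords k (\<rho> d)"]
      card_Un_le[of "star_coords k (\<rho> b)" "star_coords k (\<rho> c)"] stars by linarith
  then have "\<not> {1..k} \<subseteq> ?S"
    using k card_mono[of ?S "{1..k}"] by auto
  then obtain i where i: "i \<in> {1..k}" "i \<notin> ?S" by blast
  obtain va where va: "\<rho> a i = Some va" using fixed_rowD[OF stars(1) i(1)] by blast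
  obtain vb vc vd where v: "\<rho> b i = Some vb" "\<rho> c i = Some vc" "\<rho> d i = Some vd"
    using i unfolding star_coords_def by auto
  have "va < vb" "vb < vc" "vc < vd"
    using chain i(1) va v unfolding prec_star_def by fastforce+
  then show False using range[rule_format, OF va] range[rule_format, OF v(3)] by linarith
qed

section \<open>Completions and unavoidable domination\<close>

lemma completion_Some: "completion k \<rho> r \<Longrightarrow> i \<in> {1..k} \<Longrightarrow> \<rho> i = Some v \<Longrightarrow> r i = v"
  unfolding completion_def by (drule (1) bspec) simp

lemma completion_None: "completion k \<rho> r \<Longrightarrow> i \<in> {1..k} \<Longrightarrow> \<rho> i = None \<Longrightarrow> r i = 0 \<or> r i = 4"
  unfolding completion_def by (drule (1) bspec) simp

text \<open>Completions keep every entry that is not a star. This brings domination between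
  completed rows back to the initial rows, where chains can be excluded.\<close>

lemma completion_less_imp_prec_star:
  assumes "b \<noteq> c" "completion k (\<rho> b) (r b)" "completion k (\<rho> c) (r c)"
    and "\<And>i. i \<in> {1..k} \<Longrightarrow> r b i < r c i"
  shows "prec_star k \<rho> b c"
  unfolding prec_star_def
proof (intro conjI ballI impI)
  fix i assume i: "i \<in> {1..k}" and "\<rho> b i \<noteq> None \<and> \<rho> c i \<noteq> None"
  then obtain v w where "\<rho> b i = Some v" "\<rho> c i = Some w" by auto
  then show "the (\<rho> b i) < the (\<rho> c i)"
    using completion_Some[OF assms(2) i] completion_Some[OF assms(3) i] assms(4)[OF i] by simp
qed (fact assms(1))

lemma fixed_conflict_imp_dominated:
  assumes "fixed_conflict B k \<rho>" and "\<And>b. b \<in> B \<Longrightarrow> completion k (\<rho> b) (r b)"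
  shows "\<exists>b\<in>B. \<exists>c\<in>B. b \<noteq> c \<and> (\<forall>i\<in>{1..k}. r b i < r c i)"
proof -
  obtain b c where bc: "b \<in> B" "c \<in> B" "b \<noteq> c" "fixed_row k (\<rho> b)" "fixed_row k (\<rho> c)"
    and less: "\<And>i. i \<in> {1..k} \<Longrightarrow> the (\<rho> b i) < the (\<rho> c i)"
    using assms(1) unfolding fixed_conflict_def by blast
  have "r b i < r c i" if i: "i \<in> {1..k}" for i
  proof -
    obtain v w where "\<rho> b i = Some v" "\<rho> c i = Some w"
      using fixed_rowD[OF bc(4) i] fixed_rowD[OF bc(5) i] by blast
    then show ?thesis
      using completion_Some[OF assms(2)[OF bc(1)] i] completion_Some[OF assms(2)[OF bc(2)] i]
        less[OF i] by simp
  qed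
  then show ?thesis using bc by blast
qed

text \<open>Entries of fixed rows lie strictly between the star values 0 and 4. A star set to 0 puts
  \<open>c\<close> below the fixed row that forces 1; a star set to 4 puts \<open>c\<close> above
  the fixed row that forces 0.\<close>

lemma forcing_conflict_imp_dominated:
  assumes range: "\<forall>b i v. \<rho> b i = Some v \<longrightarrow> 1 \<le> v \<and> v \<le> 3"
    and c: "c \<in> B" and conflict: "forcing_conflict_at B k \<rho> c"
    and comp: "\<And>b. b \<in> B \<Longrightarrow> completion k (\<rho> b) (r b)"
  shows "\<exists>b\<in>B. \<exists>c\<in>B. b \<noteq> c \<and> (\<forall>i\<in>{1..k}. r b i < r c i)"
proof -
  obtain l where l: "l \<in> B" "fixed_row k (\<rho> l)" "prec_star k \<rho> l c"
    using conflict unfolding forcing_conflict_at_def directly_forced_0_def by blast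
  obtain u where u: "u \<in> B" "fixed_row k (\<rho> u)" "prec_star k \<rho> c u"
    using conflict unfolding forcing_conflict_at_def directly_forced_1_def by blast
  have "one_star_row k (\<rho> c)" using conflict unfolding forcing_conflict_at_def by blast
  then obtain j where j: "j \<in> {1..k}" "\<rho> c j = None"
    and nonstar: "\<And>i. i \<in> {1..k} \<Longrightarrow> i \<noteq> j \<Longrightarrow> \<exists>v. \<rho> c i = Some v"
    by (rule one_star_rowE) blast
  consider "r c j = 0" | "r c j = 4" using completion_None[OF comp[OF c] j] by force
  then show ?thesis
  proof cases
    case 1
    have "r c i < r u i" if i: "i \<in> {1..k}" for i
    proof -
      obtain w where w: "\<rho> u i = Some w" using fixed_rowD[OF u(2) i] by blast
      have ru: "r u i = w" using completion_Some[OF comp[OF u(1)] i w] .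
      show ?thesis
      proof (cases "i = j")
        case True
        then show ?thesis using 1 ru range[rule_format, OF w] by simp
      next
        case False
        then obtain v where v: "\<rho> c i = Some v" using nonstar[OF i] by blast
        then show ?thesis
          using u(3) i w ru completion_Some[OF comp[OF c] i v] unfolding prec_star_def by fastforce
      qed
    qed
    moreover have "c \<noteq> u" using u(3) unfolding prec_star_def by blast
    ultimately show ?thesis using c u(1) by blast
  next
    case 2
    have "r l i < r c i" if i: "i \<in> {1..k}" for i
    proof -
      obtain w where w: "\<rho> l i = Some w" using fixed_rowD[OF l(2) i] by blast
      have rl: "r l i = w" using completion_Some[OF comp[OF l(1)] i w] .
      show ?thesis
      proof (cases "i = j")
        case True
        then show ?thesis using 2 rl range[rule_format, OF w] by simp
      next
        case False
        then obtain v where v: "\<rho> c i = Some v" using nonstar[OF i] by blast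
        then show ?thesis
          using l(3) i w rl completion_Some[OF comp[OF c] i v] unfolding prec_star_def by fastforce
      qed
    qed
    moreover have "l \<noteq> c" using l(3) unfolding prec_star_def by blast
    ultimately show ?thesis using c l(1) by blast
  qed
qed

section \<open>Construction of a completion without domination\<close>

lemma exists_undominated_completion:
  assumes k: "k \<ge> 4"
    and range: "\<forall>b i v. \<rho> b i = Some v \<longrightarrow> 1 \<le> v \<and> v \<le> 3"
    and no_fixed: "\<not> fixed_conflict B k \<rho>"
    and no_forcing: "\<And>c. c \<in> B \<Longrightarrow> \<not> forcing_conflict_at B k \<rho> c"
  shows "\<exists>r. (\<forall>b\<in>B. completion k (\<rho> b) (r b)) \<and>
             \<not> (\<exists>b\<in>B. \<exists>c\<in>B. b \<noteq> c \<and> (\<forall>i\<in>{1..k}. r b i < r c i))"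
proof -
  text \<open>\<open>F\<close> consists of the rows whose variable is forced to 0, directly or through one
    implication; longer chains do not exist.\<close>
  define F where "F = {c. directly_forced_0 B k \<rho> c \<or>
    (\<exists>b. one_star_row k (\<rho> b) \<and> directly_forced_0 B k \<rho> b \<and> prec_star k \<rho> b c)}"
  \<comment> \<open>With several stars, the least one gets 0 and the others get 4. For a fixed row
    \<open>Min\<close> is applied to the empty set, but \<open>low\<close> is consulted only at
    stars.\<close>
  define low where "low b i = (if one_star_row k (\<rho> b) then b \<in> F
    else i = Min (star_coords k (\<rho> b)))" for b i
  define r where "r b i = (case \<rho> b i of Some v \<Rightarrow> v | None \<Rightarrow> if low b i then 0 else 4)" for b i
  have comp: "completion k (\<rho> b) (r b)" for b
    unfolding completion_def r_def by (auto split: option.splits)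
  have many: "(\<exists>i\<in>{1..k}. r b i = 0) \<and> (\<exists>i\<in>{1..k}. r b i = 4)"
    if nf: "\<not> fixed_row k (\<rho> b)" and no: "\<not> one_star_row k (\<rho> b)" for b
  proof -
    let ?S = "star_coords k (\<rho> b)"
    have ne: "?S \<noteq> {}" using nf unfolding fixed_row_def .
    then have m: "Min ?S \<in> ?S" by simp
    have "?S \<noteq> {Min ?S}" using no unfolding one_star_row_def by (metis is_singletonI is_singleton_altdef)
    then obtain n where n: "n \<in> ?S" "n \<noteq> Min ?S" using m by blast
    have "r b (Min ?S) = 0" "r b n = 4"
      using m n no unfolding r_def low_def by (auto simp: star_coords_def)
    then show ?thesis using m n unfolding star_coords_def by blast
  qed
  have False if bc: "b \<in> B" "c \<in> B" "b \<noteq> c" and less: "\<And>i. i \<in> {1..k} \<Longrightarrow> r b i < r c i" for b c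
  proof -
    have le4: "r a i \<le> 4" for a i
      unfolding r_def using range by (fastforce split: option.splits)
    \<comment> \<open>Nothing exceeds 4 and nothing is below 0, so neither row of a dominated pair
      can have several stars.\<close>
    have b4: "r b i \<noteq> 4" and c0: "r c i \<noteq> 0" if "i \<in> {1..k}" for i
      using less[OF that] le4[of c i] by auto
    have b: "fixed_row k (\<rho> b) \<or> one_star_row k (\<rho> b)" using many b4 by blast
    have c: "fixed_row k (\<rho> c) \<or> one_star_row k (\<rho> c)" using many c0 by blast
    have prec: "prec_star k \<rho> b c"
      using completion_less_imp_prec_star[OF bc(3) comp comp less] .
    \<comment> \<open>A star of \<open>b\<close> must have received 0 and, dually, a star of
      \<open>c\<close> must have received 4.\<close>
    have bF: "b \<in> F" if one: "one_star_row k (\<rho> b)"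
    proof -
      obtain j where "j \<in> {1..k}" "\<rho> b j = None" using one by (rule one_star_rowE)
      then show ?thesis using b4[of j] one unfolding r_def low_def by (auto split: if_splits)
    qed
    have cF: "c \<notin> F" if one: "one_star_row k (\<rho> c)"
    proof -
      obtain j where "j \<in> {1..k}" "\<rho> c j = None" using one by (rule one_star_rowE)
      then show ?thesis using c0[of j] one unfolding r_def low_def by (auto split: if_splits)
    qed
    show False
    proof (cases "one_star_row k (\<rho> b)")
      case True
      \<comment> \<open>Otherwise \<open>c\<close> would lie in \<open>F\<close>, hence would be
        fixed, and would directly force \<open>b\<close> to 1 as well.\<close>
      have "\<not> directly_forced_0 B k \<rho> b"
      proof
        assume b0: "directly_forced_0 B k \<rho> b"
        then have "c \<in> F" using True prec unfolding F_def by blast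
        then have "fixed_row k (\<rho> c)" using c cF by blast
        then have "directly_forced_1 B k \<rho> b"
          using bc prec unfolding directly_forced_1_def by blast
        then show False
          using no_forcing[OF bc(1)] True b0 unfolding forcing_conflict_at_def by blast
      qed
      \<comment> \<open>Only the second clause of \<open>F\<close> remains, and it extends the pair
        downwards to a chain \<open>l\<close>, \<open>a\<close>, \<open>b\<close>,
        \<open>c\<close>.\<close>
      then obtain a where a: "one_star_row k (\<rho> a)" "directly_forced_0 B k \<rho> a" "prec_star k \<rho> a b"
        using bF[OF True] unfolding F_def by blast
      then obtain l where l: "fixed_row k (\<rho> l)" "prec_star k \<rho> l a"
        unfolding directly_forced_0_def by blast
      have "card (star_coords k (\<rho> a)) \<le> 1" "card (star_coords k (\<rho> b)) \<le> 1"
        "card (star_coords k (\<rho> c)) \<le> 1"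
        using a(1) True c unfolding one_star_row_def fixed_row_def by auto
      then show False using no_prec_star_chain4[OF k range l(1) _ _ _ l(2) a(3) prec] by blast
    next
      case False
      then have fb: "fixed_row k (\<rho> b)" using b by blast
      show False
      proof (cases "one_star_row k (\<rho> c)")
        case True
        \<comment> \<open>The fixed row \<open>b\<close> directly forces the star of
          \<open>c\<close> to 0.\<close>
        have "c \<in> F" using bc fb prec unfolding F_def directly_forced_0_def by blast
        then show False using cF[OF True] by blast
      next
        case False
        then have fc: "fixed_row k (\<rho> c)" using c by blast
        have "\<forall>i\<in>{1..k}. the (\<rho> b i) < the (\<rho> c i)"
          using prec fixed_rowD[OF fb] fixed_rowD[OF fc] unfolding prec_star_def by fastforce
        then show False using no_fixed bc fb fc unfolding fixed_conflict_def by blast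
      qed
    qed
  qed
  then show ?thesis using comp by blast
qed

section \<open>Structure of a forcing conflict\<close>

text \<open>Off the star, the entries of \<open>L\<close>, \<open>c\<close> and \<open>U\<close>
  increase strictly within 1, 2, 3, which leaves a single possibility.\<close>

lemma forcing_conflict_values:
  assumes range: "\<forall>b i v. \<rho> b i = Some v \<longrightarrow> 1 \<le> v \<and> v \<le> 3"
    and conflict: "forcing_conflict_at B k \<rho> c" and j: "j \<in> {1..k}" "\<rho> c j = None"
  shows "\<exists>L\<in>B. \<exists>U\<in>B. fixed_row k (\<rho> L) \<and> fixed_row k (\<rho> U) \<and>
           (\<forall>i\<in>{1..k} - {j}. (\<rho> L i, \<rho> c i, \<rho> U i) = (Some 1, Some 2, Some 3))"
proof -
  obtain L where L: "L \<in> B" "fixed_row k (\<rho> L)" "prec_star k \<rho> L c"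
    using conflict unfolding forcing_conflict_at_def directly_forced_0_def by blast
  obtain U where U: "U \<in> B" "fixed_row k (\<rho> U)" "prec_star k \<rho> c U"
    using conflict unfolding forcing_conflict_at_def directly_forced_1_def by blast
  have one: "one_star_row k (\<rho> c)" using conflict unfolding forcing_conflict_at_def by blast
  have "(\<rho> L i, \<rho> c i, \<rho> U i) = (Some 1, Some 2, Some 3)" if i: "i \<in> {1..k} - {j}" for i
  proof -
    have ik: "i \<in> {1..k}" "i \<noteq> j" using i by auto
    \<comment> \<open>The star is unique, so it is the one at \<open>j\<close>.\<close>
    obtain v where v: "\<rho> c i = Some v"
      using one by (rule one_star_rowE) (use j ik in \<open>metis option.distinct(1)\<close>)
    obtain a d where ad: "\<rho> L i = Some a" "\<rho> U i = Some d"
      using fixed_rowD[OF L(2) ik(1)] fixed_rowD[OF U(2) ik(1)] by blast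
    have "a < v" "v < d"
      using L(3) U(3) ik(1) v ad unfolding prec_star_def by fastforce+
    then have "a = 1" "v = 2" "d = 3" using range[rule_format, OF ad(1)] range[rule_format, OF ad(2)] by linarith+
    then show ?thesis using v ad by simp
  qed
  then show ?thesis using L U by blast
qed

text \<open>The star at \<open>j\<close> excludes both vertices of that pair, and the value 2
  elsewhere includes both. Disjointness of the pairs keeps the two cases apart.\<close>

lemma oriented_matching_adjacent_iff:
  assumes om: "oriented_matching A k x y" and j: "j \<in> {1..k}" "initial_row E x y c j = None"
    and two: "\<And>i. i \<in> {1..k} \<Longrightarrow> i \<noteq> j \<Longrightarrow> initial_row E x y c i = Some 2"
    and a: "a \<in> A"
  shows "adjacent E c a \<longleftrightarrow> a \<notin> {x j, y j}"
proof -
  have inj: "inj_on (\<lambda>i. {x i, y i}) {1..k}"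
    and part: "partition_on A ((\<lambda>i. {x i, y i}) ` {1..k})"
    using om unfolding oriented_matching_def by auto
  have "A = \<Union> ((\<lambda>i. {x i, y i}) ` {1..k})" using partition_onD1[OF part] .
  then obtain i where i: "i \<in> {1..k}" "a \<in> {x i, y i}" using a by blast
  show ?thesis
  proof (cases "i = j")
    case True
    then show ?thesis using i j unfolding initial_row_def by (auto split: if_splits)
  next
    case False
    then have "{x i, y i} \<noteq> {x j, y j}" using inj_onD[OF inj _ i(1) j(1)] by blast
    then have "{x i, y i} \<inter> {x j, y j} = {}"
      using disjointD[OF partition_onD2[OF part]] i(1) j(1) by blast
    moreover have "adjacent E c a"
      using two[OF i(1) False] i(2) unfolding initial_row_def by (auto split: if_splits)
    ultimately show ?thesis using i(2) by blast
  qed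
qed

section \<open>Characterization of infeasible oriented matchings\<close>

theorem lemma3p1:
  fixes V A B :: "'a set" and E :: "'a set set" and k :: nat and x y :: "nat \<Rightarrow> 'a"
  assumes "k \<ge> 4"
    and "simple_graph V E"
    and "bipartition V E A B"
    and "card A = 2 * k"
    and "oriented_matching A k x y"
  shows "(\<not> feasible E B k x y \<longleftrightarrow>
            fixed_conflict B k (initial_row E x y) \<or>
            (\<exists>c\<in>B. forcing_conflict_at B k (initial_row E x y) c)) \<and>
         (\<forall>c\<in>B. \<forall>j\<in>{1..k}.
            forcing_conflict_at B k (initial_row E x y) c \<and> initial_row E x y c j = None \<longrightarrow>
            (\<exists>L\<in>B. \<exists>U\<in>B.
               fixed_row k (initial_row E x y L) \<and> fixed_row k (initial_row E x y U) \<and>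
               (\<forall>i\<in>{1..k} - {j}.
                  (initial_row E x y L i, initial_row E x y c i, initial_row E x y U i)
                    = (Some 1, Some 2, Some 3))) \<and>
            (\<forall>a\<in>A. adjacent E c a \<longleftrightarrow> a \<notin> {x j, y j}))"
proof (intro conjI ballI impI)
  let ?\<rho> = "initial_row E x y"
  note range = initial_row_range[of E x y]
  show "\<not> feasible E B k x y \<longleftrightarrow>
    fixed_conflict B k ?\<rho> \<or> (\<exists>c\<in>B. forcing_conflict_at B k ?\<rho> c)"
  proof
    assume "\<not> feasible E B k x y"
    then show "fixed_conflict B k ?\<rho> \<or> (\<exists>c\<in>B. forcing_conflict_at B k ?\<rho> c)"
      using exists_undominated_completion[of k ?\<rho> B, OF \<open>k \<ge> 4\<close> range]
      unfolding feasible_def by blast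
  next
    assume "fixed_conflict B k ?\<rho> \<or> (\<exists>c\<in>B. forcing_conflict_at B k ?\<rho> c)"
    \<comment> \<open>Either conflict produces a dominated pair in every completion, whatever values
      the stars receive.\<close>
    then have dominated: "\<exists>b\<in>B. \<exists>c\<in>B. b \<noteq> c \<and> (\<forall>i\<in>{1..k}. r b i < r c i)"
      if "\<And>b. b \<in> B \<Longrightarrow> completion k (?\<rho> b) (r b)" for r
      using fixed_conflict_imp_dominated[OF _ that] forcing_conflict_imp_dominated[OF range _ _ that]
      by (elim disjE bexE)
    show "\<not> feasible E B k x y"
    proof
      assume "feasible E B k x y"
      then obtain r where "\<forall>b\<in>B. completion k (?\<rho> b) (r b)"
        and "\<not> (\<exists>b\<in>B. \<exists>c\<in>B. b \<noteq> c \<and> (\<forall>i\<in>{1..k}. r b i < r c i))"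
        unfolding feasible_def by (elim exE conjE)
      then show False using dominated[of r] by blast
    qed
  qed
  fix c j
  assume j: "j \<in> {1..k}" and "forcing_conflict_at B k ?\<rho> c \<and> ?\<rho> c j = None"
  then have conflict: "forcing_conflict_at B k ?\<rho> c" and star: "?\<rho> c j = None" by auto
  show LU: "\<exists>L\<in>B. \<exists>U\<in>B. fixed_row k (?\<rho> L) \<and> fixed_row k (?\<rho> U) \<and>
      (\<forall>i\<in>{1..k} - {j}. (?\<rho> L i, ?\<rho> c i, ?\<rho> U i) = (Some 1, Some 2, Some 3))"
    using forcing_conflict_values[of ?\<rho>, OF range conflict j star] by blast
  fix a assume "a \<in> A"
  \<comment> \<open>The middle entries of the triples supply the value 2 at every coordinate other
    than \<open>j\<close>.\<close>
  then show "adjacent E c a \<longleftrightarrow> a \<notin> {x j, y j}"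
    using oriented_matching_adjacent_iff[OF \<open>oriented_matching A k x y\<close> j star _ \<open>a \<in> A\<close>] LU by auto
qed

end
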